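(* For every graph $G$, the following two conditions are equivalent: (1) there is an $N\in\mathbb{N}$ such that $\chi_{\ell flex}(K_p\vee G)=\chi(K_p\vee G)$ whenever $p\geq N$; (2) for every $S\subseteq V(G)$ with $|S|=\omega(G)+1$, there is a proper $\chi(G)$-coloring of $G$ that uses at most $\omega(G)=|S|-1$ colors on $S$.
   Context: All graphs are nonempty, finite, and simple, and $\mathbb{N}=\{1,2,3,\ldots\}$. $\omega(G)$, $\alpha(G)$, $\chi(G)$ denote the clique number, independence number, and chromatic number. A proper $m$-coloring is a proper coloring with colors from $\{1,\ldots,m\}$. $G \vee H$ denotes the join of vertex-disjoint graphs $G$ and $H$ (every vertex of $G$ is made adjacent to every vertex of $H$), and $K_p$ is the complete graph on $p$ vertices. The Hall ratio of $G$ is $\rho(G)=\max_{\emptyset\neq H\subseteq G} |V(H)|/\alpha(H)$, the maximum being over all nonempty subgraphs $H$ of $G$. A list assignment $L$ for $G$ assigns to each vertex $v$ a set $L(v)$ of colors; it is a $k$-assignment if $|L(v)|=k$ for every $v \in V(G)$. A proper $L$-coloring of $G$ is a proper coloring $f$ with $f(v)\in L(v)$ for all $v \in V(G)$. A request of $L$ is a function $r$ with nonempty domain $D \subseteq V(G)$ such that $r(v)\in L(v)$ for each $v\in D$. For $\epsilon\in[0,1]$, the triple $(G,L,r)$ is $\epsilon$-satisfiable if there is a proper $L$-coloring $f$ of $G$ with $f(v)=r(v)$ for at least $\epsilon|D|$ vertices $v\in D$. The pair $(G,L)$ is $\epsilon$-flexible if $(G,L,r)$ is $\epsilon$-satisfiable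 for every request $r$ of $L$. $G$ is $(k,\epsilon)$-flexible if $(G,L)$ is $\epsilon$-flexible for every $k$-assignment $L$ for $G$. The list flexibility number $\chi_{\ell flex}(G)$ is the smallest $k$ such that $G$ is $(k,1/\rho(G))$-flexible. *)

theory Defs
  imports Complex_Main
begin

record 'a sgraph =
  verts :: "'a set"
  edges :: "'a set set"

definition simple_graph :: "'a sgraph \<Rightarrow> bool" where
  "simple_graph G \<longleftrightarrow>
     finite (verts G) \<and> verts G \<noteq> {} \<and> (\<forall>e\<in>edges G. e \<subseteq> verts G \<and> card e = 2)"

definition subgraph :: "'a sgraph \<Rightarrow> 'a sgraph \<Rightarrow> bool" where
  "subgraph H G \<longleftrightarrow> simple_graph H \<and> verts H \<subseteq> verts G \<and> edges H \<subseteq> edges G"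

definition complete_graph :: "nat \<Rightarrow> nat sgraph" where
  "complete_graph p =
     \<lparr>verts = {..<p}, edges = {{i, j} | i j. i < p \<and> j < p \<and> i \<noteq> j}\<rparr>"

text \<open>The sum type makes the two vertex sets disjoint.\<close>

definition join :: "'a sgraph \<Rightarrow> 'b sgraph \<Rightarrow> ('a + 'b) sgraph" where
  "join G H =
     \<lparr>verts = verts G <+> verts H,
      edges = image Inl ` edges G \<union> image Inr ` edges H
            \<union> {{Inl u, Inr v} | u v. u \<in> verts G \<and> v \<in> verts H}\<rparr>"

definition clique :: "'a sgraph \<Rightarrow> 'a set \<Rightarrow> bool" where
  "clique G K \<longleftrightarrow> K \<subseteq> verts G \<and> (\<forall>u\<in>K. \<forall>v\<in>K. u \<noteq> v \<longrightarrow> {u, v} \<in> edges G)"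

definition independent_set :: "'a sgraph \<Rightarrow> 'a set \<Rightarrow> bool" where
  "independent_set G I \<longleftrightarrow> I \<subseteq> verts G \<and> (\<forall>u\<in>I. \<forall>v\<in>I. {u, v} \<notin> edges G)"

definition clique_number :: "'a sgraph \<Rightarrow> nat" where
  "clique_number G = Max {card K | K. clique G K}"

definition independence_number :: "'a sgraph \<Rightarrow> nat" where
  "independence_number G = Max {card I | I. independent_set G I}"

definition proper_coloring :: "'a sgraph \<Rightarrow> ('a \<Rightarrow> 'c) \<Rightarrow> bool" where
  "proper_coloring G f \<longleftrightarrow>
     (\<forall>u\<in>verts G. \<forall>v\<in>verts G. {u, v} \<in> edges G \<longrightarrow> f u \<noteq> f v)"

definition proper_m_coloring :: "'a sgraph \<Rightarrow> nat \<Rightarrow> ('a \<Rightarrow> nat) \<Rightarrow> bool" where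
  "proper_m_coloring G m f \<longleftrightarrow> proper_coloring G f \<and> f ` verts G \<subseteq> {1..m}"

definition chromatic_number :: "'a sgraph \<Rightarrow> nat" where
  "chromatic_number G = (LEAST m. \<exists>f. proper_m_coloring G m f)"

definition hall_ratio :: "'a sgraph \<Rightarrow> real" where
  "hall_ratio G =
     Max {real (card (verts H)) / real (independence_number H) | H. subgraph H G}"

text \<open>
  Colors in list assignments are natural numbers. This is no restriction: a list assignment with
  finite lists on a finite graph uses only finitely many colors.
\<close>

definition k_assignment :: "'a sgraph \<Rightarrow> nat \<Rightarrow> ('a \<Rightarrow> nat set) \<Rightarrow> bool" where
  "k_assignment G k L \<longleftrightarrow> (\<forall>v\<in>verts G. finite (L v) \<and> card (L v) = k)"

definition proper_L_coloring :: "'a sgraph \<Rightarrow> ('a \<Rightarrow> nat set) \<Rightarrow> ('a \<Rightarrow> nat) \<Rightarrow> bool" where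
  "proper_L_coloring G L f \<longleftrightarrow> proper_coloring G f \<and> (\<forall>v\<in>verts G. f v \<in> L v)"

definition request :: "'a sgraph \<Rightarrow> ('a \<Rightarrow> nat set) \<Rightarrow> ('a \<rightharpoonup> nat) \<Rightarrow> bool" where
  "request G L r \<longleftrightarrow>
     dom r \<noteq> {} \<and> dom r \<subseteq> verts G \<and> (\<forall>v\<in>dom r. the (r v) \<in> L v)"

definition satisfiable ::
    "real \<Rightarrow> 'a sgraph \<Rightarrow> ('a \<Rightarrow> nat set) \<Rightarrow> ('a \<rightharpoonup> nat) \<Rightarrow> bool" where
  "satisfiable \<epsilon> G L r \<longleftrightarrow>
     (\<exists>f. proper_L_coloring G L f \<and>
          real (card {v \<in> dom r. f v = the (r v)}) \<ge> \<epsilon> * real (card (dom r)))"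

definition pair_flexible :: "real \<Rightarrow> 'a sgraph \<Rightarrow> ('a \<Rightarrow> nat set) \<Rightarrow> bool" where
  "pair_flexible \<epsilon> G L \<longleftrightarrow> (\<forall>r. request G L r \<longrightarrow> satisfiable \<epsilon> G L r)"

definition flexible :: "nat \<Rightarrow> real \<Rightarrow> 'a sgraph \<Rightarrow> bool" where
  "flexible k \<epsilon> G \<longleftrightarrow> (\<forall>L. k_assignment G k L \<longrightarrow> pair_flexible \<epsilon> G L)"

text \<open>
  The bound \<open>1 \<le> k\<close> is essential: empty lists admit no request, so every graph is vacuously
  \<open>(0, \<epsilon>)\<close>-flexible.
\<close>

definition list_flexibility_number :: "'a sgraph \<Rightarrow> nat" where
  "list_flexibility_number G = (LEAST k. 1 \<le> k \<and> flexible k (1 / hall_ratio G) G)"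

end

theory Submission imports Defs begin

text \<open>
  Let \<open>n\<close>, \<open>\<omega>\<close>, \<open>\<chi>\<close> be the order, clique number and chromatic number of \<open>G\<close>, and write \<open>cone p G\<close>
  for the join of \<open>K\<^sub>p\<close> with \<open>G\<close>, whose chromatic number is \<open>p + \<chi>\<close>. If \<open>p \<ge> n\<close>, its Hall ratio is
  \<open>p + \<omega>\<close>: a larger set of vertices contains two nonadjacent ones and has at most
  \<open>p + n \<le> 2 (p + \<omega>)\<close> elements (\<open>hall_ratio_cone\<close>). The same count bounds the number of requests
  that have to be met: one if the domain \<open>D\<close> of the request has at most \<open>p + \<omega>\<close> vertices, and two
  otherwise. Since flexibility with lists of size at least one implies colorability, and lists as
  long as the order of the graph always suffice, the list flexibility number equals the chromatic
  number iff lists of size \<open>p + \<chi>\<close> allow this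
  (\<open>list_flexibility_number_eq_chromatic_number_iff\<close>).

  Suppose that they do, and let \<open>card S = \<omega> + 1\<close>. Take equal lists and request one and the same
  color on all of \<open>K\<^sub>p\<close> and \<open>S\<close>, which together have \<open>p + \<omega> + 1\<close> vertices. Two of them receive this
  color; they are not adjacent, so both lie in \<open>S\<close>. The coloring leaves only \<open>\<chi>\<close> colors for \<open>G\<close>,
  so it is a \<open>\<chi>\<close>-coloring of \<open>G\<close> that repeats a color on \<open>S\<close>
  (\<open>coloring_repeating_on_subset\<close>).

  Conversely, assume that every set of \<open>\<omega> + 1\<close> vertices of \<open>G\<close> has a repeated color in some proper
  \<open>\<chi>\<close>-coloring, let \<open>p > n\<^sup>2 + 2\<close>, and let lists of size \<open>p + \<chi>\<close> and a request
  with domain \<open>D\<close> be given (\<open>flexible_cone\<close>). The main tool is \<open>refining_coloring_class\<close>: for every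
  proper \<open>\<chi>\<close>-coloring of \<open>G\<close>, every color class of it and every color \<open>c\<close>, there is a proper list
  coloring that uses \<open>c\<close> on all vertices of the class whose lists contain \<open>c\<close>. This meets any single
  request at a vertex of \<open>G\<close>. Coloring a vertex of \<open>K\<^sub>p\<close> and deleting its color from all other lists
  lowers \<open>p\<close> and the list sizes by at most one each, so single requests on \<open>K\<^sub>p\<close>, and two requests for
  different colors with one of them on \<open>K\<^sub>p\<close>, can be met too. If \<open>card D > p + \<omega>\<close>, then \<open>D\<close> meets
  \<open>K\<^sub>p\<close>, so only the case is left that \<open>D\<close> requests the same color \<open>c\<close> everywhere. Then \<open>D\<close> contains
  at least \<open>\<omega> + 1\<close> vertices of \<open>G\<close>, some \<open>\<chi>\<close>-coloring has two of them in one
  class, and \<open>refining_coloring_class\<close> colors both with \<open>c\<close>.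

  For \<open>refining_coloring_class\<close>, delete \<open>c\<close> from the lists and let \<open>X\<close> be a largest set of uncolored
  vertices that violates Hall's condition. By maximality the other vertices can be given distinct
  colors that occur on no list in \<open>X\<close>. The lists of \<open>X\<close> have fewer than \<open>p + n\<close> colors in total and
  at least \<open>p + \<chi> - 1\<close> each, so they are almost equal; hence, as \<open>p > n\<^sup>2\<close>, there are \<open>\<chi>\<close> colors
  common to all lists of \<open>X \<inter> V(G)\<close>, one for each color class. The one color lost with \<open>c\<close> can be
  made up for (\<open>refining_coloring_few_colors\<close>).
\<close>

section \<open>Hall's theorem\<close>

text \<open>
  The proof of Halmos and Vaughan: if some proper nonempty subset is tight, match it first and the
  rest into the remaining colors; otherwise any single choice keeps Hall's condition.
\<close>

theorem hall_marriage:
  fixes L :: "'v \<Rightarrow> 'c set"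
  assumes "finite U" and "\<And>Y. Y \<subseteq> U \<Longrightarrow> card Y \<le> card (\<Union>(L ` Y))"
  shows "\<exists>f. inj_on f U \<and> (\<forall>v\<in>U. f v \<in> L v)"
  using assms
proof (induction "card U" arbitrary: U L rule: less_induct)
  case less
  note fin = \<open>finite U\<close> and hall = less.prems(2)
  have finL: "finite (L v)" if "v \<in> U" for v
    using hall[of "{v}"] that by (auto intro: card_ge_0_finite)
  have finUn: "finite (\<Union>(L ` Y))" if "Y \<subseteq> U" for Y
    using that finL fin by (auto dest: finite_subset)
  consider "U = {}"
    | (crit) Y where "Y \<noteq> {}" "Y \<subset> U" "card (\<Union>(L ` Y)) = card Y"
    | (slack) "U \<noteq> {}" "\<And>Y. Y \<noteq> {} \<Longrightarrow> Y \<subset> U \<Longrightarrow> card Y < card (\<Union>(L ` Y))"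
    using hall by (metis le_neq_implies_less psubset_imp_subset)
  then show ?case
  proof cases
    case 1
    then show ?thesis by simp
  next
    case crit
    let ?N = "\<Union>(L ` Y)"
    have finY: "finite Y" using crit(2) fin finite_subset by blast
    have "card Y < card U" using crit(2) fin psubset_card_mono by blast
    then obtain f1 where f1: "inj_on f1 Y" "\<forall>v\<in>Y. f1 v \<in> L v"
      using less.hyps[of Y L] finY hall crit(2) by (meson psubset_imp_subset subset_trans)
    have "card (U - Y) < card U"
      using crit fin by (intro psubset_card_mono) auto
    moreover have "card Z \<le> card (\<Union>((\<lambda>v. L v - ?N) ` Z))" if Z: "Z \<subseteq> U - Y" for Z
    proof -
      have finZ: "finite Z" using Z fin finite_subset by blast
      have "card Z + card Y = card (Z \<union> Y)"
        using Z finZ finY by (intro card_Un_disjoint[symmetric]) auto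
      also have "\<dots> \<le> card (\<Union>(L ` (Z \<union> Y)))"
        using Z crit(2) by (intro hall) auto
      also have "\<Union>(L ` (Z \<union> Y)) = \<Union>((\<lambda>v. L v - ?N) ` Z) \<union> ?N" by auto
      also have "card \<dots> \<le> card (\<Union>((\<lambda>v. L v - ?N) ` Z)) + card ?N" by (rule card_Un_le)
      finally show ?thesis using crit(3) by simp
    qed
    ultimately obtain f2 where f2: "inj_on f2 (U - Y)" "\<forall>v\<in>U - Y. f2 v \<in> L v - ?N"
      using less.hyps[of "U - Y" "\<lambda>v. L v - ?N"] fin by auto
    let ?f = "\<lambda>v. if v \<in> Y then f1 v else f2 v"
    have "inj_on ?f U"
    proof (rule inj_onI)
      fix u v assume uv: "u \<in> U" "v \<in> U" "?f u = ?f v"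
      have "f1 w \<in> ?N" if "w \<in> Y" for w using f1(2) that by blast
      moreover have "f2 w \<notin> ?N" if "w \<in> U - Y" for w using f2(2) that by blast
      ultimately show "u = v"
        using uv inj_onD[OF f1(1), of u v] inj_onD[OF f2(1), of u v]
        by (metis DiffI)
    qed
    moreover have "\<forall>v\<in>U. ?f v \<in> L v" using f1 f2 by auto
    ultimately show ?thesis by blast
  next
    case slack
    then obtain u where u: "u \<in> U" by blast
    obtain c where c: "c \<in> L u" using hall[of "{u}"] u by fastforce
    have "card (U - {u}) < card U" by (rule card_Diff1_less[OF fin u])
    moreover have "card Z \<le> card (\<Union>((\<lambda>v. L v - {c}) ` Z))" if Z: "Z \<subseteq> U - {u}" for Z
    proof (cases "Z = {}")
      case False
      have "card Z < card (\<Union>(L ` Z))" using False Z u by (intro slack(2)) auto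
      also have "\<Union>(L ` Z) \<subseteq> insert c (\<Union>((\<lambda>v. L v - {c}) ` Z))" by auto
      then have "card (\<Union>(L ` Z)) \<le> card (insert c (\<Union>((\<lambda>v. L v - {c}) ` Z)))"
        using finUn[of Z] Z by (intro card_mono) (auto intro: finite_subset[of _ "\<Union>(L ` Z)"])
      also have "\<dots> \<le> Suc (card (\<Union>((\<lambda>v. L v - {c}) ` Z)))" by (rule card_insert_le_m1) auto
      finally show ?thesis by simp
    qed simp
    ultimately obtain f where f: "inj_on f (U - {u})" "\<forall>v\<in>U - {u}. f v \<in> L v - {c}"
      using less.hyps[of "U - {u}" "\<lambda>v. L v - {c}"] fin by auto
    have "inj_on (f(u := c)) U"
      using f unfolding inj_on_def by (auto; metis DiffI singletonD singletonI)
    moreover have "\<forall>v\<in>U. (f(u := c)) v \<in> L v" using f c by auto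
    ultimately show ?thesis by blast
  qed
qed

corollary sdr_of_large_lists:
  fixes L :: "'v \<Rightarrow> 'c set"
  assumes "finite U" "\<And>v. v \<in> U \<Longrightarrow> finite (L v) \<and> card U \<le> card (L v)"
  shows "\<exists>f. inj_on f U \<and> (\<forall>v\<in>U. f v \<in> L v)"
proof (rule hall_marriage[OF assms(1)])
  fix Y assume Y: "Y \<subseteq> U"
  show "card Y \<le> card (\<Union>(L ` Y))"
  proof (cases "Y = {}")
    case False
    then obtain v where v: "v \<in> Y" by blast
    have "card Y \<le> card U" using Y assms(1) card_mono by blast
    also have "\<dots> \<le> card (L v)" using v Y assms(2) by blast
    also have "\<dots> \<le> card (\<Union>(L ` Y))"
      using v Y assms by (intro card_mono) (auto dest: finite_subset)
    finally show ?thesis .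
  qed simp
qed

text \<open>
  A largest violator \<open>X\<close> of Hall's condition collects the whole obstruction: a set outside \<open>X\<close> that
  violates the condition for the lists without the colors of \<open>X\<close> could be added to \<open>X\<close>.
\<close>

lemma sdr_outside_deficient_set:
  fixes L :: "'v \<Rightarrow> 'c set"
  assumes fin: "finite U" and finL: "\<And>v. v \<in> U \<Longrightarrow> finite (L v)"
  obtains X f where "X \<subseteq> U" "X = {} \<or> card (\<Union>(L ` X)) < card X"
    "inj_on f (U - X)" "\<forall>v\<in>U - X. f v \<in> L v - \<Union>(L ` X)"
proof -
  define XX where "XX = {X. X \<subseteq> U \<and> (X = {} \<or> card (\<Union>(L ` X)) < card X)}"
  have "finite XX" unfolding XX_def using fin by simp
  moreover have "XX \<noteq> {}" unfolding XX_def by blast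
  ultimately have "Max (card ` XX) \<in> card ` XX" by (intro Max_in) auto
  then obtain X where X: "X \<in> XX" and "card X = Max (card ` XX)" by auto
  then have maxX: "card Y \<le> card X" if "Y \<in> XX" for Y
    using that \<open>finite XX\<close> by simp
  have XU: "X \<subseteq> U" and Xd: "X = {} \<or> card (\<Union>(L ` X)) < card X" using X by (auto simp: XX_def)
  have finX: "finite X" using XU fin finite_subset by blast
  have Xle: "card (\<Union>(L ` X)) \<le> card X" using Xd by auto
  have "\<exists>f. inj_on f (U - X) \<and> (\<forall>v\<in>U - X. f v \<in> L v - \<Union>(L ` X))"
  proof (rule hall_marriage)
    fix Y assume Y: "Y \<subseteq> U - X"
    have finY: "finite Y" using Y fin finite_subset by blast
    show "card Y \<le> card (\<Union>v\<in>Y. L v - \<Union>(L ` X))"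
    proof (rule ccontr)
      assume neg: "\<not> ?thesis"
      have "\<Union>(L ` (Y \<union> X)) = (\<Union>v\<in>Y. L v - \<Union>(L ` X)) \<union> \<Union>(L ` X)" by auto
      then have "card (\<Union>(L ` (Y \<union> X))) \<le> card (\<Union>v\<in>Y. L v - \<Union>(L ` X)) + card (\<Union>(L ` X))"
        by (simp only: card_Un_le)
      also have "\<dots> < card Y + card X" using neg Xle by linarith
      also have "\<dots> = card (Y \<union> X)"
        using Y finX finY by (intro card_Un_disjoint[symmetric]) auto
      finally have "Y \<union> X \<in> XX" using Y XU by (auto simp: XX_def)
      then have "card (Y \<union> X) \<le> card X" by (rule maxX)
      moreover have "card (Y \<union> X) = card Y + card X"
        using Y finX finY by (intro card_Un_disjoint) auto
      ultimately show False using neg by simp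
    qed
  qed (use fin in auto)
  then show ?thesis using that XU Xd by blast
qed

section \<open>List colorings of a clique joined to a partitioned set\<close>

text \<open>
  When \<open>P\<close> is a clique completely joined to \<open>V\<close> and \<open>g\<close> is a proper coloring of the graph on \<open>V\<close>,
  these are proper list colorings of the join. Stating the conditions through \<open>g\<close> instead of the edges
  keeps only the partition of \<open>V\<close> into color classes, which is all that the arguments below use.
\<close>

definition refining_coloring ::
    "'v set \<Rightarrow> 'v set \<Rightarrow> ('v \<Rightarrow> 'c set) \<Rightarrow> ('v \<Rightarrow> nat) \<Rightarrow> ('v \<Rightarrow> 'c) \<Rightarrow> bool" where
  "refining_coloring P V L g f \<longleftrightarrow>
     (\<forall>v\<in>P \<union> V. f v \<in> L v)
     \<and> (\<forall>u\<in>P. \<forall>v\<in>P \<union> V. f u = f v \<longrightarrow> u = v)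
     \<and> (\<forall>u\<in>V. \<forall>v\<in>V. f u = f v \<longrightarrow> g u = g v)"

lemma refining_coloringI:
  assumes "\<And>v. v \<in> P \<union> V \<Longrightarrow> f v \<in> L v"
    and "\<And>u v. u \<in> P \<Longrightarrow> v \<in> P \<union> V \<Longrightarrow> f u = f v \<Longrightarrow> u = v"
    and "\<And>u v. u \<in> V \<Longrightarrow> v \<in> V \<Longrightarrow> f u = f v \<Longrightarrow> g u = g v"
  shows "refining_coloring P V L g f"
  unfolding refining_coloring_def using assms by (intro conjI ballI impI)

lemma refining_coloringD:
  assumes "refining_coloring P V L g f"
  shows "v \<in> P \<union> V \<Longrightarrow> f v \<in> L v"
    and "u \<in> P \<Longrightarrow> v \<in> P \<union> V \<Longrightarrow> f u = f v \<Longrightarrow> u = v"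
    and "u \<in> V \<Longrightarrow> v \<in> V \<Longrightarrow> f u = f v \<Longrightarrow> g u = g v"
  using assms unfolding refining_coloring_def by blast+

text \<open>
  Each of the at most \<open>n\<close> lists misses at most \<open>n\<close> colors of \<open>C\<close>, so at most \<open>n * n\<close> colors of \<open>W\<close>
  are missed by some list. The function \<open>t\<close> picks \<open>m\<close> of the others, one for each class of a partition
  into \<open>m\<close> classes.
\<close>

lemma common_colors:
  fixes L :: "'v \<Rightarrow> 'c set"
  assumes finC: "finite C" and W: "W \<subseteq> C" "m + n * n \<le> card W"
    and B: "finite B" "card B \<le> n"
    and L: "\<And>v. v \<in> B \<Longrightarrow> L v \<subseteq> C \<and> card C \<le> card (L v) + n"
  shows "\<exists>t. inj_on t {1..m} \<and> (\<forall>i\<in>{1..m}. t i \<in> W \<and> (\<forall>v\<in>B. t i \<in> L v))"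
proof -
  let ?K = "W - (\<Union>v\<in>B. C - L v)"
  have "card (C - L v) \<le> n" if "v \<in> B" for v
    using L[OF that] finC by (auto simp: card_Diff_subset finite_subset)
  then have "(\<Sum>v\<in>B. card (C - L v)) \<le> card B * n"
    using sum_bounded_above[of B "\<lambda>v. card (C - L v)" n] by simp
  also have "\<dots> \<le> n * n" using B by simp
  finally have "card (\<Union>v\<in>B. C - L v) \<le> n * n"
    using card_UN_le[OF B(1), of "\<lambda>v. C - L v"] by linarith
  moreover have "card W - card (\<Union>v\<in>B. C - L v) \<le> card ?K"
    using B finC by (intro diff_card_le_card_Diff) auto
  ultimately have "card {1..m} \<le> card ?K" using W by simp
  moreover have "finite ?K" using finC W finite_subset by blast
  ultimately obtain t where "t ` {1..m} \<subseteq> ?K" "inj_on t {1..m}"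
    using card_le_inj[of "{1..m}" ?K] by auto
  then show ?thesis using W by (intro exI[of _ t]) blast
qed

text \<open>
  The lists are nearly equal here, because their union is small, so every class can get a color common
  to all lists of \<open>B\<close>, leaving at least \<open>q - 1\<close> colors for each vertex of the clique \<open>Z\<close>. That is one
  short of the \<open>q\<close> needed when \<open>card Z = q\<close>, and it fails only if all lists on \<open>Z\<close> are the same
  set \<open>W\<close> of \<open>q + m - 1\<close> colors. Then the lists of the distinguished class \<open>j\<close>, which are one larger, contain
  colors outside \<open>W\<close>. With these on class \<open>j\<close> and common colors from \<open>W\<close> on the other \<open>m - 1\<close>
  classes, \<open>Z\<close> keeps \<open>q\<close> colors.
\<close>

lemma refining_coloring_few_colors:
  fixes L :: "'v \<Rightarrow> 'c set"
  assumes fin: "finite Z" "finite B" and disj: "Z \<inter> B = {}"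
    and sz: "card Z \<le> q" "card B \<le> n" "n * n < q"
    and few: "finite (\<Union>(L ` (Z \<union> B)))" "card (\<Union>(L ` (Z \<union> B))) < q + n"
    and low: "\<And>v. v \<in> Z \<union> B \<Longrightarrow> q + m \<le> Suc (card (L v))"
    and lowj: "\<And>v. v \<in> B \<Longrightarrow> g v = j \<Longrightarrow> q + m \<le> card (L v)"
    and g: "g ` B \<subseteq> {1..m}" and j: "j \<in> {1..m}"
  shows "\<exists>h. refining_coloring Z B L g h"
proof (cases "Z \<union> B = {}")
  case True
  then show ?thesis by (simp add: refining_coloring_def)
next
  case False
  define C where "C = \<Union>(L ` (Z \<union> B))"
  have finC: "finite C" and cardC: "card C < q + n" using few by (auto simp: C_def)
  have LC: "L v \<subseteq> C" if "v \<in> Z \<union> B" for v using that by (auto simp: C_def)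
  have finL: "finite (L v)" if "v \<in> Z \<union> B" for v using LC[OF that] finC finite_subset by blast
  have m: "1 \<le> m" using j by simp
  have near: "L v \<subseteq> C \<and> card C \<le> card (L v) + n" if "v \<in> B" for v
    using LC[of v] low[of v] that cardC m by auto
  \<comment> \<open>\<open>wide\<close> is Hall's condition on \<open>Z\<close> after the loss of any \<open>m\<close> colors.\<close>
  consider
    (wide) "\<And>Y. Y \<noteq> {} \<Longrightarrow> Y \<subseteq> Z \<Longrightarrow> card Y + m \<le> card (\<Union>(L ` Y))"
    | (narrow) Y where "Y \<noteq> {}" "Y \<subseteq> Z" "card (\<Union>(L ` Y)) < card Y + m"
    by (meson not_le)
  then show ?thesis
  proof cases
    case wide
    obtain v where v: "v \<in> Z \<union> B" using False by blast
    have "card (L v) \<le> card C" using LC[OF v] finC card_mono by blast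
    then have "m + n * n \<le> card C" using low[OF v] sz by linarith
    from common_colors[OF finC subset_refl this fin(2) sz(2), where L = L] near
    obtain t where t: "inj_on t {1..m}"
      "\<And>i v. i \<in> {1..m} \<Longrightarrow> v \<in> B \<Longrightarrow> t i \<in> L v"
      by blast
    have "\<exists>s. inj_on s Z \<and> (\<forall>v\<in>Z. s v \<in> L v - t ` {1..m})"
    proof (rule hall_marriage[OF fin(1)])
      fix Y assume Y: "Y \<subseteq> Z"
      show "card Y \<le> card (\<Union>v\<in>Y. L v - t ` {1..m})"
      proof (cases "Y = {}")
        case False
        have "card (t ` {1..m}) \<le> m" using card_image_le[of "{1..m}" t] by simp
        moreover have "card (\<Union>(L ` Y)) - card (t ` {1..m}) \<le> card (\<Union>(L ` Y) - t ` {1..m})"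
          by (intro diff_card_le_card_Diff) auto
        ultimately have "card Y \<le> card (\<Union>(L ` Y) - t ` {1..m})"
          using wide[OF False Y] by linarith
        also have "\<Union>(L ` Y) - t ` {1..m} = (\<Union>v\<in>Y. L v - t ` {1..m})" by auto
        finally show ?thesis .
      qed simp
    qed
    then obtain s where s: "inj_on s Z" "\<forall>v\<in>Z. s v \<in> L v - t ` {1..m}" by blast
    let ?h = "\<lambda>v. if v \<in> Z then s v else t (g v)"
    have hB: "?h v = t (g v)" "g v \<in> {1..m}" if "v \<in> B" for v
      using that disj g by auto
    have "refining_coloring Z B L g ?h"
    proof (rule refining_coloringI)
      fix v assume "v \<in> Z \<union> B"
      then show "?h v \<in> L v" using s(2) t(2) hB(2) by auto
    next
      fix u v assume u: "u \<in> Z" and v: "v \<in> Z \<union> B" and eq: "?h u = ?h v"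
      show "u = v"
      proof (cases "v \<in> Z")
        case True
        then show ?thesis using u eq inj_onD[OF s(1)] by simp
      next
        case False
        then have "t (g v) \<in> t ` {1..m}" "s u = t (g v)" using hB v u eq by auto
        then show ?thesis using s(2) u by auto
      qed
    next
      fix u v assume "u \<in> B" "v \<in> B" "?h u = ?h v"
      then show "g u = g v" using hB inj_onD[OF t(1), of "g u" "g v"] by simp
    qed
    then show ?thesis by blast
  next
    case narrow
    \<comment> \<open>The bounds force \<open>Y = Z\<close>, \<open>card Z = q\<close> and \<open>card W = q + m - 1\<close>.\<close>
    define W where "W = \<Union>(L ` Y)"
    obtain y where y: "y \<in> Y" using narrow(1) by blast
    have WC: "W \<subseteq> C" using narrow(2) by (auto simp: W_def C_def)
    have finW: "finite W" using WC finC finite_subset by blast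
    have "card (L y) \<le> card W" using y finW by (intro card_mono) (auto simp: W_def)
    moreover have "q + m \<le> Suc (card (L y))" using y narrow(2) low by blast
    ultimately have Wlow: "q + m \<le> Suc (card W)" by linarith
    have "card Y \<le> card Z" using narrow(2) fin card_mono by blast
    moreover have Wup: "card W < card Y + m" using narrow(3) by (simp add: W_def)
    ultimately have "card Y = card Z" "card Z = q" using Wlow sz by linarith+
    then have YZ: "Y = Z" using narrow(2) fin card_subset_eq by blast
    have LW: "L v \<subseteq> W" if "v \<in> Z" for v using that YZ by (auto simp: W_def)
    have "m + n * n \<le> card W" using Wlow sz by linarith
    from common_colors[OF finC WC this fin(2) sz(2), where L = L] near
    obtain t where t: "inj_on t {1..m}" "\<And>i. i \<in> {1..m} \<Longrightarrow> t i \<in> W"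
      "\<And>i v. i \<in> {1..m} \<Longrightarrow> v \<in> B \<Longrightarrow> t i \<in> L v"
      by blast
    \<comment> \<open>Colors outside \<open>W\<close> clash neither with \<open>Z\<close> nor with the other classes, so each vertex of
      class \<open>j\<close> may choose its own: vertices of one class may agree or differ.\<close>
    let ?T = "t ` ({1..m} - {j})"
    have "\<exists>a. a \<in> L v - W" if v: "v \<in> B" "g v = j" for v
    proof (rule ccontr)
      assume "\<nexists>a. a \<in> L v - W"
      then have "card (L v) \<le> card W" using finW by (intro card_mono) auto
      then show False using lowj[OF v] Wup sz \<open>card Y = card Z\<close> by linarith
    qed
    then obtain a where a: "\<And>v. v \<in> B \<Longrightarrow> g v = j \<Longrightarrow> a v \<in> L v - W" by metis
    have "card ?T \<le> m - 1"
      using card_image_le[of "{1..m} - {j}" t] j by simp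
    have "\<exists>s. inj_on s Z \<and> (\<forall>v\<in>Z. s v \<in> L v - ?T)"
    proof (rule sdr_of_large_lists[OF fin(1)], rule conjI)
      fix v assume v: "v \<in> Z"
      show "finite (L v - ?T)" using finL v by blast
      have "card (L v) - card ?T \<le> card (L v - ?T)"
        by (intro diff_card_le_card_Diff) auto
      then show "card Z \<le> card (L v - ?T)"
        using \<open>card ?T \<le> m - 1\<close> low[of v] v m \<open>card Z = q\<close> by auto
    qed
    then obtain s where s: "inj_on s Z" "\<forall>v\<in>Z. s v \<in> L v - ?T" by blast
    let ?h = "\<lambda>v. if v \<in> Z then s v else if g v = j then a v else t (g v)"
    have hB: "?h v = (if g v = j then a v else t (g v))" if "v \<in> B" for v
      using that disj by auto
    have tg: "t (g v) \<in> ?T" "t (g v) \<in> W" if "v \<in> B" "g v \<noteq> j" for v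
      using that g t(2) by auto
    have "refining_coloring Z B L g ?h"
    proof (rule refining_coloringI)
      fix v assume "v \<in> Z \<union> B"
      then show "?h v \<in> L v" using s(2) t(3) g a by auto
    next
      fix u v assume u: "u \<in> Z" and v: "v \<in> Z \<union> B" and eq: "?h u = ?h v"
      have su: "s u \<in> W" "s u \<notin> ?T" using s(2) u LW[OF u] by auto
      show "u = v"
      proof (cases "v \<in> Z")
        case True
        then show ?thesis using u eq inj_onD[OF s(1)] by simp
      next
        case False
        then have vB: "v \<in> B" and *: "s u = (if g v = j then a v else t (g v))"
          using v u eq by auto
        show ?thesis
        proof (cases "g v = j")
          case True
          then show ?thesis using * a[OF vB] su by simp
        next
          case False
          then show ?thesis using * tg(1)[OF vB] su by simp
        qed
      qed
    next
      fix u v assume u: "u \<in> B" and v: "v \<in> B" and eq: "?h u = ?h v"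
      have eq': "(if g u = j then a u else t (g u)) = (if g v = j then a v else t (g v))"
        using eq hB[OF u] hB[OF v] by simp
      have gm: "g u \<in> {1..m}" "g v \<in> {1..m}" using u v g by auto
      consider "g u = j" "g v = j" | "g u = j" "g v \<noteq> j" | "g u \<noteq> j" "g v = j"
        | "g u \<noteq> j" "g v \<noteq> j" by blast
      then show "g u = g v"
      proof cases
        case 2
        then show ?thesis using eq' a[OF u] tg(2)[OF v] by simp
      next
        case 3
        then show ?thesis using eq' a[OF v] tg(2)[OF u] by simp
      next
        case 4
        then show ?thesis using eq' inj_onD[OF t(1) _ gm] by simp
      qed simp
    qed
    then show ?thesis by blast
  qed
qed

text \<open>
  Once the vertices \<open>I\<close> of class \<open>j\<close> that can have color \<open>c\<close> do have it, \<open>c\<close> is deleted everywhere else,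
  and a list loses at most one color. The remaining vertices of class \<open>j\<close> lose none, which is the
  surplus that \<open>refining_coloring_few_colors\<close> relies on. It deals with the largest violator \<open>X\<close> of
  Hall's condition; everything outside \<open>X\<close> gets distinct colors that do not occur in \<open>X\<close>.
\<close>

lemma refining_coloring_class:
  fixes L :: "'v \<Rightarrow> 'c set"
  assumes fin: "finite P" "finite V" and disj: "P \<inter> V = {}"
    and large: "card V * card V < card P"
    and L: "\<And>v. v \<in> P \<union> V \<Longrightarrow> finite (L v) \<and> card P + m \<le> card (L v)"
    and g: "g ` V \<subseteq> {1..m}" and j: "j \<in> {1..m}"
  shows "\<exists>f. refining_coloring P V L g f \<and> (\<forall>v\<in>V. g v = j \<and> c \<in> L v \<longrightarrow> f v = c)"
proof -
  define I where "I = {v \<in> V. g v = j \<and> c \<in> L v}"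
  define L' where "L' v = L v - {c}" for v
  define U where "U = (P \<union> V) - I"
  have finU: "finite U" using fin by (simp add: U_def)
  have finL': "finite (L' v)" if "v \<in> U" for v using that L by (auto simp: U_def L'_def)
  obtain X s where X: "X \<subseteq> U" "X = {} \<or> card (\<Union>(L' ` X)) < card X"
    and s: "inj_on s (U - X)" "\<forall>v\<in>U - X. s v \<in> L' v - \<Union>(L' ` X)"
    using sdr_outside_deficient_set[OF finU, of L'] finL' by metis
  let ?Z = "P \<inter> X" and ?B = "V \<inter> X"
  have XZB: "X = ?Z \<union> ?B" using X(1) by (auto simp: U_def)
  have "\<exists>h. refining_coloring ?Z ?B L' g h"
  proof (cases "X = {}")
    case True
    then show ?thesis by (simp add: refining_coloring_def)
  next
    case False
    have finX: "finite X" using X(1) finU finite_subset by blast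
    have "card X \<le> card (P \<union> V)" using X(1) fin by (intro card_mono) (auto simp: U_def)
    also have "\<dots> \<le> card P + card V" by (rule card_Un_le)
    finally have few: "card (\<Union>(L' ` X)) < card P + card V" using X(2) False by linarith
    show ?thesis
    proof (rule refining_coloring_few_colors[where q = "card P" and n = "card V" and m = m and j = j])
      show "finite ?Z" "finite ?B" "?Z \<inter> ?B = {}" using fin disj by auto
      show "card ?Z \<le> card P" "card ?B \<le> card V" using fin by (auto intro: card_mono)
      show "finite (\<Union>(L' ` (?Z \<union> ?B)))"
        using finX X(1) finL' unfolding XZB[symmetric] by blast
      show "card (\<Union>(L' ` (?Z \<union> ?B))) < card P + card V"
        using few unfolding XZB[symmetric] .
      show "card P + m \<le> Suc (card (L' v))" if "v \<in> ?Z \<union> ?B" for v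
      proof -
        have "card P + m \<le> card (L v)" using L that by blast
        then show ?thesis using card_Diff1_le[of "L v" c] diff_card_le_card_Diff[of "{c}" "L v"]
          by (simp add: L'_def)
      qed
      show "card P + m \<le> card (L' v)" if "v \<in> ?B" "g v = j" for v
      proof -
        have "c \<notin> L v" using that X(1) by (auto simp: U_def I_def)
        then have "L' v = L v" by (simp add: L'_def)
        then show ?thesis using L that by auto
      qed
    qed (use large g j in auto)
  qed
  then obtain h where h: "refining_coloring ?Z ?B L' g h" by blast
  have hL: "h v \<in> L' v" if "v \<in> X" for v
    using refining_coloringD(1)[OF h, of v] that X(1) by (auto simp: U_def)
  have hP: "u = v" if "u \<in> X" "v \<in> X" "u \<in> P" "h u = h v" for u v
    using refining_coloringD(2)[OF h, of u v] that X(1) by (auto simp: U_def)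
  have hV: "g u = g v" if "u \<in> X" "v \<in> X" "u \<in> V" "v \<in> V" "h u = h v" for u v
    using refining_coloringD(3)[OF h, of u v] that by simp
  define f where "f v = (if v \<in> I then c else if v \<in> X then h v else s v)" for v
  have cases: "v \<in> I \<and> f v = c \<or> v \<in> X \<and> f v = h v \<and> f v \<in> L' v
      \<or> v \<in> U - X \<and> f v = s v \<and> f v \<in> L' v - \<Union>(L' ` X)" if vPV: "v \<in> P \<union> V" for v
  proof -
    consider "v \<in> I" | "v \<notin> I" "v \<in> X" | "v \<in> U - X" using vPV unfolding U_def by blast
    then show ?thesis
    proof cases
      case 2
      then show ?thesis using hL by (simp add: f_def)
    next
      case 3
      then have "f v = s v" by (simp add: f_def U_def)
      then show ?thesis using 3 s(2) by metis
    qed (simp add: f_def)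
  qed
  have ncL': "c \<notin> L' v" for v by (simp add: L'_def)
  have IV: "I \<subseteq> V" by (auto simp: I_def)
  have same: "u \<in> I \<and> v \<in> I \<or> u \<in> X \<and> v \<in> X \<and> h u = h v \<or> u = v"
    if "u \<in> P \<union> V" "v \<in> P \<union> V" "f u = f v" for u v
  proof -
    have I: "f w = c \<longleftrightarrow> w \<in> I" if "w \<in> P \<union> V" for w
      using cases[OF that] ncL'[of w] by (auto simp: f_def)
    have X: "f w \<in> \<Union>(L' ` X) \<longleftrightarrow> w \<in> X" if "w \<in> P \<union> V" "w \<notin> I" for w
      using cases[OF that(1)] that(2) by auto
    consider "u \<in> I" | "u \<notin> I" "u \<in> X" | "u \<notin> I" "u \<notin> X" by blast
    then show ?thesis
    proof cases
      case 1
      then show ?thesis using I[OF that(1)] I[OF that(2)] that(3) by simp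
    next
      case 2
      then have "v \<notin> I" using I[OF that(1)] I[OF that(2)] that(3) by simp
      then have "v \<in> X" using X[OF that(1)] X[OF that(2)] 2 that(3) by simp
      then show ?thesis using 2 \<open>v \<notin> I\<close> that(3) by (simp add: f_def)
    next
      case 3
      then have vI: "v \<notin> I" using I[OF that(1)] I[OF that(2)] that(3) by simp
      then have vX: "v \<notin> X" using X[OF that(1)] X[OF that(2)] 3 that(3) by simp
      have "u \<in> U - X" "v \<in> U - X" using 3 vI vX that by (simp_all add: U_def)
      moreover have "s u = s v" using 3 vI vX that(3) by (simp add: f_def)
      ultimately show ?thesis using inj_onD[OF s(1)] by simp
    qed
  qed
  have "refining_coloring P V L g f"
  proof (rule refining_coloringI)
    fix v assume "v \<in> P \<union> V"
    from cases[OF this] show "f v \<in> L v" by (auto simp: I_def L'_def)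
  next
    fix u v assume uv: "u \<in> P" "v \<in> P \<union> V" "f u = f v"
    have "u \<notin> I" using uv(1) IV disj by auto
    then show "u = v" using same[of u v] uv hP[of u v] by auto
  next
    fix u v assume uv: "u \<in> V" "v \<in> V" "f u = f v"
    from same[of u v] uv hV[of u v] show "g u = g v" by (auto simp: I_def)
  qed
  moreover have "\<forall>v\<in>V. g v = j \<and> c \<in> L v \<longrightarrow> f v = c" by (simp add: f_def I_def)
  ultimately show ?thesis by blast
qed

text \<open>
  A vertex \<open>d\<close> of the clique conflicts with every other vertex, so any color may be reserved for it at
  the price of one color on the other lists, while the clique to be colored shrinks by one as well.
\<close>

lemma refining_coloring_add_clique_vertex:
  assumes "refining_coloring (P - {d}) V (\<lambda>v. L v - {x}) g f" "d \<in> P" "d \<notin> V" "x \<in> L d"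
  shows "refining_coloring P V L g (f(d := x))"
proof -
  have f: "f v \<in> L v" "f v \<noteq> x" if "v \<in> P \<union> V" "v \<noteq> d" for v
    using refining_coloringD(1)[OF assms(1), of v] that by auto
  show ?thesis
  proof (rule refining_coloringI)
    fix v assume "v \<in> P \<union> V"
    then show "(f(d := x)) v \<in> L v" using f(1) assms(4) by simp
  next
    fix u v assume uv: "u \<in> P" "v \<in> P \<union> V" "(f(d := x)) u = (f(d := x)) v"
    consider "u = d" "v = d" | "u = d" "v \<noteq> d" | "u \<noteq> d" "v = d" | "u \<noteq> d" "v \<noteq> d" by blast
    then show "u = v"
      using uv f(2)[of u] f(2)[of v] refining_coloringD(2)[OF assms(1), of u v] by cases auto
  next
    fix u v assume "u \<in> V" "v \<in> V" "(f(d := x)) u = (f(d := x)) v"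
    then show "g u = g v"
      using refining_coloringD(3)[OF assms(1), of u v] assms(3) by (auto split: if_splits)
  qed
qed

lemma card_Diff_singleton_ge:
  assumes "k + 1 \<le> card A"
  shows "k \<le> card (A - {x})"
  using assms diff_card_le_card_Diff[of "{x}" A] by simp

lemma refining_coloring_one_request:
  fixes L :: "'v \<Rightarrow> 'c set"
  assumes fin: "finite P" "finite V" and disj: "P \<inter> V = {}"
    and large: "card V * card V + 1 < card P"
    and L: "\<And>v. v \<in> P \<union> V \<Longrightarrow> finite (L v) \<and> card P + m \<le> card (L v)"
    and g: "g ` V \<subseteq> {1..m}" and m: "1 \<le> m"
    and d: "d \<in> P \<union> V" "x \<in> L d"
  shows "\<exists>f. refining_coloring P V L g f \<and> f d = x"
proof (cases "d \<in> V")
  case True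
  have "\<exists>f. refining_coloring P V L g f \<and> (\<forall>v\<in>V. g v = g d \<and> x \<in> L v \<longrightarrow> f v = x)"
    using large g True L by (intro refining_coloring_class[OF fin disj, where m = m]) auto
  then show ?thesis using True d(2) by blast
next
  case False
  then have dP: "d \<in> P" using d by blast
  have cP: "card P = card (P - {d}) + 1" using dP fin(1) by (metis Suc_eq_plus1 card.remove)
  have "\<exists>f. refining_coloring (P - {d}) V (\<lambda>v. L v - {x}) g f \<and>
          (\<forall>v\<in>V. g v = 1 \<and> x \<in> L v - {x} \<longrightarrow> f v = x)"
  proof (rule refining_coloring_class[where m = m])
    show "finite (L v - {x}) \<and> card (P - {d}) + m \<le> card (L v - {x})" if "v \<in> P - {d} \<union> V" for v
      using L[of v] that cP by (auto intro!: card_Diff_singleton_ge)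
  qed (use fin disj large cP g m in auto)
  then obtain f where "refining_coloring (P - {d}) V (\<lambda>v. L v - {x}) g f" by blast
  then have "refining_coloring P V L g (f(d := x))"
    using refining_coloring_add_clique_vertex dP False d(2) by metis
  then show ?thesis by (metis fun_upd_same)
qed

lemma refining_coloring_two_requests:
  fixes L :: "'v \<Rightarrow> 'c set"
  assumes fin: "finite P" "finite V" and disj: "P \<inter> V = {}"
    and large: "card V * card V + 2 < card P"
    and L: "\<And>v. v \<in> P \<union> V \<Longrightarrow> finite (L v) \<and> card P + m \<le> card (L v)"
    and g: "g ` V \<subseteq> {1..m}" and m: "1 \<le> m"
    and d: "d \<in> P" "x \<in> L d" and e: "e \<in> P \<union> V" "e \<noteq> d" "y \<in> L e" "y \<noteq> x"
  shows "\<exists>f. refining_coloring P V L g f \<and> f d = x \<and> f e = y"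
proof -
  have cP: "card P = card (P - {d}) + 1" using d fin(1) by (metis Suc_eq_plus1 card.remove)
  have "\<exists>f. refining_coloring (P - {d}) V (\<lambda>v. L v - {x}) g f \<and> f e = y"
  proof (rule refining_coloring_one_request[where m = m])
    show "finite (L v - {x}) \<and> card (P - {d}) + m \<le> card (L v - {x})" if "v \<in> P - {d} \<union> V" for v
      using L[of v] that cP by (auto intro!: card_Diff_singleton_ge)
  qed (use fin disj large cP g m e in auto)
  then obtain f where f: "refining_coloring (P - {d}) V (\<lambda>v. L v - {x}) g f" "f e = y" by blast
  have "refining_coloring P V L g (f(d := x))"
    using refining_coloring_add_clique_vertex[OF f(1)] d disj by blast
  then show ?thesis using f(2) e(2) by (metis fun_upd_apply)
qed

section \<open>Cliques, independent sets and colorings of simple graphs\<close>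

lemma simple_graph_edgeD:
  assumes "simple_graph G" "{u, v} \<in> edges G"
  shows "u \<noteq> v" "u \<in> verts G" "v \<in> verts G"
proof -
  have "{u, v} \<subseteq> verts G" "card {u, v} = 2" using assms by (auto simp: simple_graph_def)
  then show "u \<noteq> v" "u \<in> verts G" "v \<in> verts G" by auto
qed

lemma finite_cards_of_subsets:
  assumes "finite A" "\<And>K. Q K \<Longrightarrow> K \<subseteq> A"
  shows "finite {card K | K. Q K}"
  by (rule finite_subset[of _ "card ` Pow A"]) (use assms in auto)

lemma card_clique_le:
  assumes "simple_graph G" "clique G K"
  shows "card K \<le> clique_number G"
  unfolding clique_number_def
  by (rule Max_ge, rule finite_cards_of_subsets[of "verts G"])
    (use assms in \<open>auto simp: simple_graph_def clique_def\<close>)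

lemma maximum_clique:
  assumes "simple_graph G"
  obtains K where "clique G K" "card K = clique_number G"
proof -
  have "finite {card K | K. clique G K}"
    by (rule finite_cards_of_subsets[of "verts G"])
      (use assms in \<open>auto simp: simple_graph_def clique_def\<close>)
  moreover have "clique G {}" by (simp add: clique_def)
  ultimately have "clique_number G \<in> {card K | K. clique G K}"
    unfolding clique_number_def by (intro Max_in) auto
  then show ?thesis using that by auto
qed

lemma card_independent_set_le:
  assumes "simple_graph G" "independent_set G I"
  shows "card I \<le> independence_number G"
  unfolding independence_number_def
  by (rule Max_ge, rule finite_cards_of_subsets[of "verts G"])
    (use assms in \<open>auto simp: simple_graph_def independent_set_def\<close>)

lemma maximum_independent_set:
  assumes "simple_graph G"
  obtains I where "independent_set G I" "card I = independence_number G"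
proof -
  have "finite {card I | I. independent_set G I}"
    by (rule finite_cards_of_subsets[of "verts G"])
      (use assms in \<open>auto simp: simple_graph_def independent_set_def\<close>)
  moreover have "independent_set G {}" by (simp add: independent_set_def)
  ultimately have "independence_number G \<in> {card I | I. independent_set G I}"
    unfolding independence_number_def by (intro Max_in) auto
  then show ?thesis using that by auto
qed

lemma independence_number_pos:
  assumes "simple_graph G"
  shows "1 \<le> independence_number G"
proof -
  obtain v where "v \<in> verts G" using assms by (auto simp: simple_graph_def)
  then have "independent_set G {v}"
    using simple_graph_edgeD(1)[OF assms, of v v] by (auto simp: independent_set_def)
  then show ?thesis using card_independent_set_le[OF assms] by fastforce
qed

lemma proper_recoloring:
  assumes "finite (verts G)" "proper_coloring G f" "card (f ` verts G) \<le> m"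
  obtains \<phi> where "inj_on \<phi> (f ` verts G)" "proper_m_coloring G m (\<phi> \<circ> f)"
proof -
  obtain \<phi> where \<phi>: "\<phi> ` f ` verts G \<subseteq> {1..m}" "inj_on \<phi> (f ` verts G)"
    using card_le_inj[of "f ` verts G" "{1..m}"] assms by auto
  have "proper_coloring G (\<phi> \<circ> f)"
    using assms(2) inj_onD[OF \<phi>(2)] unfolding proper_coloring_def comp_def by blast
  then show ?thesis using \<phi> by (intro that[of \<phi>]) (auto simp: proper_m_coloring_def)
qed

lemma chromatic_number_le:
  assumes "finite (verts G)" "proper_coloring G f" "card (f ` verts G) \<le> m"
  shows "chromatic_number G \<le> m"
proof -
  obtain \<phi> where "proper_m_coloring G m (\<phi> \<circ> f)" using proper_recoloring[OF assms] by blast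
  then show ?thesis unfolding chromatic_number_def by (intro Least_le) blast
qed

lemma optimal_coloring:
  assumes "simple_graph G"
  obtains f where "proper_m_coloring G (chromatic_number G) f"
proof -
  have "finite (verts G)" using assms by (simp add: simple_graph_def)
  moreover have "proper_coloring G id"
    using simple_graph_edgeD(1)[OF assms] by (auto simp: proper_coloring_def)
  moreover have "card (id ` verts G) \<le> card (verts G)" by simp
  ultimately obtain \<phi> where "proper_m_coloring G (card (verts G)) (\<phi> \<circ> id)"
    by (rule proper_recoloring)
  then have "\<exists>m f. proper_m_coloring G m f" by blast
  then have "\<exists>f. proper_m_coloring G (chromatic_number G) f"
    unfolding chromatic_number_def by (rule LeastI_ex)
  then show ?thesis using that by blast
qed

lemma chromatic_number_pos:
  assumes "simple_graph G"
  shows "1 \<le> chromatic_number G"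
proof -
  obtain f where "proper_m_coloring G (chromatic_number G) f" using optimal_coloring[OF assms] .
  moreover obtain v where "v \<in> verts G" using assms by (auto simp: simple_graph_def)
  ultimately have "f v \<in> {1..chromatic_number G}" by (auto simp: proper_m_coloring_def)
  then show ?thesis by simp
qed

section \<open>Hall ratio and flexibility\<close>

lemma finite_hall_ratios:
  assumes "simple_graph G"
  shows "finite {real (card (verts H)) / real (independence_number H) | H. subgraph H G}"
proof (rule finite_subset)
  let ?n = "card (verts G)"
  have finG: "finite (verts G)" using assms by (simp add: simple_graph_def)
  show "finite ((\<lambda>(a, b). real a / real b) ` ({..?n} \<times> {..?n}))" by simp
  have "card (verts H) \<le> ?n \<and> independence_number H \<le> ?n" if H: "subgraph H G" for H
  proof -
    have sH: "simple_graph H" and HG: "verts H \<subseteq> verts G" using H by (auto simp: subgraph_def)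
    obtain I where I: "independent_set H I" "card I = independence_number H"
      using maximum_independent_set[OF sH] .
    then have "I \<subseteq> verts G" using HG by (auto simp: independent_set_def)
    then show ?thesis using card_mono[OF finG] HG I(2) by metis
  qed
  then show "{real (card (verts H)) / real (independence_number H) | H. subgraph H G}
      \<subseteq> (\<lambda>(a, b). real a / real b) ` ({..?n} \<times> {..?n})"
    by fastforce
qed

lemma hall_ratio_ge:
  assumes "simple_graph G" "subgraph H G"
  shows "real (card (verts H)) / real (independence_number H) \<le> hall_ratio G"
  unfolding hall_ratio_def using finite_hall_ratios[OF assms(1)] assms(2) by (intro Max_ge) auto

text \<open>
  The Hall ratio is the constant for which every set of vertices contains a proportionally large
  independent set: apply its definition to the induced subgraph.
\<close>

lemma independent_subset_hall_ratio:
  assumes G: "simple_graph G" and D: "D \<subseteq> verts G" "D \<noteq> {}"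
  obtains I where "independent_set G I" "I \<subseteq> D"
    "1 / hall_ratio G * real (card D) \<le> real (card I)"
proof -
  define H where "H = \<lparr>verts = D, edges = {e \<in> edges G. e \<subseteq> D}\<rparr>"
  have finD: "finite D" using G D finite_subset by (auto simp: simple_graph_def)
  have sH: "simple_graph H" using G D finD by (auto simp: simple_graph_def H_def)
  then have sub: "subgraph H G" using D by (auto simp: subgraph_def H_def)
  obtain I where I: "independent_set H I" "card I = independence_number H"
    using maximum_independent_set[OF sH] .
  have ID: "I \<subseteq> D" using I by (auto simp: independent_set_def H_def)
  moreover have "independent_set G I"
    using I ID D unfolding independent_set_def H_def by auto
  moreover have I1: "0 < real (card I)" using independence_number_pos[OF sH] I(2) by simp
  have le: "real (card D) / real (card I) \<le> hall_ratio G"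
    using hall_ratio_ge[OF G sub] I(2) by (simp add: H_def)
  moreover have "0 < real (card D)" using D finD by (simp add: card_gt_0_iff)
  ultimately have "0 < hall_ratio G" using I1 by (smt (verit) divide_pos_pos)
  then have "1 / hall_ratio G * real (card D) \<le> real (card I)"
    using le I1 by (simp add: field_simps)
  then show ?thesis using that ID \<open>independent_set G I\<close> by blast
qed

text \<open>
  Some list size always works, so the least one in \<open>list_flexibility_number\<close> is attained: grant the
  requests on a large independent subset of the domain and give distinct new colors to all other
  vertices.
\<close>

lemma flexible_card_verts:
  assumes G: "simple_graph G"
  shows "flexible (card (verts G)) (1 / hall_ratio G) G"
  unfolding flexible_def pair_flexible_def
proof (intro allI impI)
  fix L r assume L: "k_assignment G (card (verts G)) L" and r: "request G L r"
  have fin: "finite (verts G)" using G by (simp add: simple_graph_def)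
  have D: "dom r \<subseteq> verts G" "dom r \<noteq> {}" using r by (auto simp: request_def)
  obtain I where I: "independent_set G I" "I \<subseteq> dom r"
    "1 / hall_ratio G * real (card (dom r)) \<le> real (card I)"
    using independent_subset_hall_ratio[OF G D] .
  let ?R = "(\<lambda>v. the (r v)) ` I"
  have IV: "I \<subseteq> verts G" using I(2) D(1) by (rule subset_trans)
  then have finI: "finite I" using fin by (rule finite_subset)
  have "card ?R \<le> card I" using finI by (rule card_image_le)
  have "\<exists>s. inj_on s (verts G - I) \<and> (\<forall>v\<in>verts G - I. s v \<in> L v - ?R)"
  proof (rule sdr_of_large_lists)
    show "finite (verts G - I)" using fin by simp
    fix v assume v: "v \<in> verts G - I"
    have Lv: "finite (L v)" "card (L v) = card (verts G)" using L v by (auto simp: k_assignment_def)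
    have "card (verts G - I) = card (verts G) - card I"
      using finI IV by (rule card_Diff_subset)
    also have "\<dots> \<le> card (L v) - card ?R" using Lv \<open>card ?R \<le> card I\<close> by simp
    also have "\<dots> \<le> card (L v - ?R)" using finI by (intro diff_card_le_card_Diff) auto
    finally show "finite (L v - ?R) \<and> card (verts G - I) \<le> card (L v - ?R)" using Lv by simp
  qed
  then obtain s where s: "inj_on s (verts G - I)" "\<forall>v\<in>verts G - I. s v \<in> L v - ?R" by blast
  define f where "f v = (if v \<in> I then the (r v) else s v)" for v
  have "f u \<noteq> f v" if uv: "u \<in> verts G" "v \<in> verts G" "{u, v} \<in> edges G" for u v
  proof -
    have "\<not> (u \<in> I \<and> v \<in> I)" using I(1) uv(3) by (auto simp: independent_set_def)
    moreover have "u \<noteq> v" using simple_graph_edgeD(1)[OF G uv(3)] .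
    moreover have "s w \<noteq> the (r x)" if "w \<in> verts G - I" "x \<in> I" for w x using s(2) that by blast
    ultimately show ?thesis
      using uv(1,2) inj_onD[OF s(1), of u v] unfolding f_def by (smt (verit) DiffI)
  qed
  moreover have "f v \<in> L v" if "v \<in> verts G" for v
  proof (cases "v \<in> I")
    case True
    then show ?thesis using r I(2) by (auto simp: f_def request_def)
  next
    case False
    then show ?thesis using s(2) that by (auto simp: f_def)
  qed
  ultimately have "proper_L_coloring G L f" by (simp add: proper_L_coloring_def proper_coloring_def)
  moreover have "card I \<le> card {v \<in> dom r. f v = the (r v)}"
    using I(2) finite_subset[OF D(1) fin] by (intro card_mono) (auto simp: f_def)
  then have "1 / hall_ratio G * real (card (dom r)) \<le> real (card {v \<in> dom r. f v = the (r v)})"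
    using I(3) by linarith
  ultimately show "satisfiable (1 / hall_ratio G) G L r" unfolding satisfiable_def by blast
qed

lemma chromatic_number_le_flexible:
  assumes G: "simple_graph G" and k: "1 \<le> k" and flex: "flexible k \<epsilon> G"
  shows "chromatic_number G \<le> k"
proof -
  obtain v where v: "v \<in> verts G" using G by (auto simp: simple_graph_def)
  have "k_assignment G k (\<lambda>_. {1..k})" by (simp add: k_assignment_def)
  moreover have "request G (\<lambda>_. {1..k}) [v \<mapsto> 1]" using v k by (simp add: request_def)
  ultimately have "satisfiable \<epsilon> G (\<lambda>_. {1..k}) [v \<mapsto> 1]"
    using flex by (simp add: flexible_def pair_flexible_def)
  then obtain f where "proper_L_coloring G (\<lambda>_. {1..k}) f"
    unfolding satisfiable_def by blast
  then have f: "proper_coloring G f" "f ` verts G \<subseteq> {1..k}"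
    unfolding proper_L_coloring_def by blast+
  have "card (f ` verts G) \<le> k" using card_mono[OF _ f(2)] by simp
  then show ?thesis using chromatic_number_le[OF _ f(1)] G by (simp add: simple_graph_def)
qed

lemma list_flexibility_number_eq_chromatic_number_iff:
  assumes G: "simple_graph G"
  shows "list_flexibility_number G = chromatic_number G
    \<longleftrightarrow> flexible (chromatic_number G) (1 / hall_ratio G) G"
proof
  let ?P = "\<lambda>k. 1 \<le> k \<and> flexible k (1 / hall_ratio G) G"
  have "1 \<le> card (verts G)" using G by (simp add: simple_graph_def Suc_leI card_gt_0_iff)
  then have "?P (card (verts G))" using flexible_card_verts[OF G] by blast
  then have "?P (list_flexibility_number G)"
    unfolding list_flexibility_number_def by (rule LeastI)
  then show "flexible (chromatic_number G) (1 / hall_ratio G) G"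
    if "list_flexibility_number G = chromatic_number G" using that by simp
  show "list_flexibility_number G = chromatic_number G"
    if "flexible (chromatic_number G) (1 / hall_ratio G) G"
    unfolding list_flexibility_number_def
    using that chromatic_number_pos[OF G] chromatic_number_le_flexible[OF G]
    by (intro Least_equality) auto
qed

lemma satisfiableI:
  assumes "proper_L_coloring G L f" "finite (dom r)" "A \<subseteq> dom r" "\<And>v. v \<in> A \<Longrightarrow> f v = the (r v)"
    and "card (dom r) \<le> card A * k" "0 < k"
  shows "satisfiable (1 / real k) G L r"
proof -
  have "card A \<le> card {v \<in> dom r. f v = the (r v)}"
    using assms by (intro card_mono) auto
  then have "card A * k \<le> card {v \<in> dom r. f v = the (r v)} * k" by simp
  then have "card (dom r) \<le> card {v \<in> dom r. f v = the (r v)} * k" using assms(5) by linarith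
  then have "real (card (dom r)) \<le> real (card {v \<in> dom r. f v = the (r v)}) * real k"
    by (metis of_nat_le_iff of_nat_mult)
  then have "1 / real k * real (card (dom r)) \<le> real (card {v \<in> dom r. f v = the (r v)})"
    using assms(6) by (simp add: field_simps)
  then show ?thesis using assms(1) unfolding satisfiable_def by blast
qed

section \<open>Joins with complete graphs\<close>

abbreviation cone :: "nat \<Rightarrow> 'a sgraph \<Rightarrow> (nat + 'a) sgraph" where
  "cone p G \<equiv> join (complete_graph p) G"

lemma verts_cone: "verts (cone p G) = Inl ` {..<p} \<union> Inr ` verts G"
  by (auto simp: join_def complete_graph_def)

lemma edges_cone:
  "{Inl i, Inl j} \<in> edges (cone p G) \<longleftrightarrow> i < p \<and> j < p \<and> i \<noteq> j"
  "{Inl i, Inr v} \<in> edges (cone p G) \<longleftrightarrow> i < p \<and> v \<in> verts G"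
  "{Inr v, Inl i} \<in> edges (cone p G) \<longleftrightarrow> i < p \<and> v \<in> verts G"
  "{Inr u, Inr v} \<in> edges (cone p G) \<longleftrightarrow> {u, v} \<in> edges G"
proof -
  have inl: "{Inl i, Inl j} = (Inl ` e :: (nat + 'a) set) \<longleftrightarrow> {i, j} = e" for i j and e
    using inj_image_eq_iff[OF inj_Inl, of "{i, j}" e] by simp
  have inr: "{Inr u, Inr v} = (Inr ` e :: (nat + 'a) set) \<longleftrightarrow> {u, v} = e" for u v and e
    using inj_image_eq_iff[OF inj_Inr, of "{u, v}" e] by simp
  show "{Inl i, Inl j} \<in> edges (cone p G) \<longleftrightarrow> i < p \<and> j < p \<and> i \<noteq> j"
    by (auto simp: join_def complete_graph_def image_iff inl doubleton_eq_iff)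
  show mixed: "{Inl i, Inr v} \<in> edges (cone p G) \<longleftrightarrow> i < p \<and> v \<in> verts G"
    by (auto simp: join_def complete_graph_def doubleton_eq_iff image_iff)
  then show "{Inr v, Inl i} \<in> edges (cone p G) \<longleftrightarrow> i < p \<and> v \<in> verts G"
    by (simp add: insert_commute)
  show "{Inr u, Inr v} \<in> edges (cone p G) \<longleftrightarrow> {u, v} \<in> edges G"
    by (auto simp: join_def complete_graph_def image_iff inr doubleton_eq_iff)
qed

lemma card_verts_cone:
  assumes "finite (verts G)"
  shows "finite (verts (cone p G))" "card (verts (cone p G)) = p + card (verts G)"
proof -
  have "card (Inl ` {..<p} \<union> Inr ` verts G) = card (Inl ` {..<p} :: (nat + 'a) set) + card (Inr ` verts G :: (nat + 'a) set)"
    using assms by (intro card_Un_disjoint) auto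
  then show "card (verts (cone p G)) = p + card (verts G)"
    by (simp add: verts_cone card_image)
  show "finite (verts (cone p G))" using assms by (simp add: verts_cone)
qed

lemma simple_graph_cone:
  assumes "simple_graph G"
  shows "simple_graph (cone p G)"
proof -
  have "e \<subseteq> verts (cone p G) \<and> card e = 2" if "e \<in> edges (cone p G)" for e
    using that assms
    by (auto simp: join_def complete_graph_def simple_graph_def card_image inj_on_def)
  then show ?thesis
    using assms by (auto simp: simple_graph_def verts_cone)
qed

lemma proper_L_coloring_coneI:
  assumes "refining_coloring (Inl ` {..<p}) (Inr ` verts G) L (case_sum (\<lambda>_. 0) g) f"
    and "proper_coloring G g"
  shows "proper_L_coloring (cone p G) L f"
proof -
  have P: "u = v" if "u \<in> Inl ` {..<p}" "v \<in> verts (cone p G)" "f u = f v" for u v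
    using refining_coloringD(2)[OF assms(1)] that by (simp add: verts_cone)
  have V: "g u = g v" if "u \<in> verts G" "v \<in> verts G" "f (Inr u) = f (Inr v)" for u v
    using refining_coloringD(3)[OF assms(1), of "Inr u" "Inr v"] that by simp
  have "f u \<noteq> f v" if uv: "u \<in> verts (cone p G)" "v \<in> verts (cone p G)" "{u, v} \<in> edges (cone p G)" for u v
  proof
    assume eq: "f u = f v"
    show False
    proof (cases u)
      case (Inl i)
      then have "u = v" using P[of u v] uv eq by (auto simp: verts_cone)
      then have "{Inl i, Inl i} \<in> edges (cone p G)" using uv(3) Inl by metis
      then show False using edges_cone(1)[of i i p G] by blast
    next
      case u: (Inr x)
      show False
      proof (cases v)
        case (Inl i)
        then have "v = u" using P[of v u] uv eq by (auto simp: verts_cone)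
        then show False using u Inl by simp
      next
        case (Inr y)
        then have "g x = g y" "{x, y} \<in> edges G" "x \<in> verts G" "y \<in> verts G"
          using V[of x y] uv eq u by (auto simp: edges_cone verts_cone)
        then show False using assms(2) by (auto simp: proper_coloring_def)
      qed
    qed
  qed
  moreover have "\<forall>v\<in>verts (cone p G). f v \<in> L v"
    using refining_coloringD(1)[OF assms(1)] by (simp add: verts_cone)
  ultimately show ?thesis by (simp add: proper_L_coloring_def proper_coloring_def)
qed

lemma proper_coloring_coneD:
  assumes "finite (verts G)" "proper_coloring (cone p G) f"
  shows "proper_coloring G (f \<circ> Inr)"
    and "p + card ((f \<circ> Inr) ` verts G) = card (f ` verts (cone p G))"
proof -
  have ne: "f u \<noteq> f v" if "u \<in> verts (cone p G)" "v \<in> verts (cone p G)" "{u, v} \<in> edges (cone p G)" for u v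
    using assms that by (simp add: proper_coloring_def)
  show "proper_coloring G (f \<circ> Inr)"
    unfolding proper_coloring_def using ne by (auto simp: verts_cone edges_cone)
  have "inj_on (f \<circ> Inl) {..<p}"
    using ne[of "Inl i" "Inl j" for i j] by (auto simp: inj_on_def verts_cone edges_cone)
  then have "card ((f \<circ> Inl) ` {..<p}) = p" by (simp only: card_image card_lessThan)
  moreover have "(f \<circ> Inl) ` {..<p} \<inter> (f \<circ> Inr) ` verts G = {}"
    using ne[of "Inl i" "Inr v" for i v] by (auto simp: verts_cone edges_cone)
  then have "card ((f \<circ> Inl) ` {..<p} \<union> (f \<circ> Inr) ` verts G)
      = card ((f \<circ> Inl) ` {..<p}) + card ((f \<circ> Inr) ` verts G)"
    using assms(1) by (intro card_Un_disjoint) auto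
  moreover have "f ` verts (cone p G) = (f \<circ> Inl) ` {..<p} \<union> (f \<circ> Inr) ` verts G"
    by (auto simp: verts_cone)
  ultimately show "p + card ((f \<circ> Inr) ` verts G) = card (f ` verts (cone p G))" by simp
qed

lemma chromatic_number_cone:
  assumes G: "simple_graph G"
  shows "chromatic_number (cone p G) = p + chromatic_number G"
proof (rule antisym)
  have fin: "finite (verts G)" using G by (simp add: simple_graph_def)
  obtain g where g: "proper_m_coloring G (chromatic_number G) g" using optimal_coloring[OF G] .
  let ?f = "case_sum (\<lambda>i. Suc (chromatic_number G + i)) g"
  have g1: "proper_coloring G g" "\<And>v. v \<in> verts G \<Longrightarrow> g v \<in> {1..chromatic_number G}"
    using g by (auto simp: proper_m_coloring_def)
  have "refining_coloring (Inl ` {..<p}) (Inr ` verts G) (\<lambda>_. {1..p + chromatic_number G})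
      (case_sum (\<lambda>_. 0) g) ?f"
    using g1(2) by (intro refining_coloringI) fastforce+
  then have *: "proper_L_coloring (cone p G) (\<lambda>_. {1..p + chromatic_number G}) ?f"
    using g1(1) by (rule proper_L_coloring_coneI)
  then have "?f ` verts (cone p G) \<subseteq> {1..p + chromatic_number G}"
    unfolding proper_L_coloring_def by blast
  then have "card (?f ` verts (cone p G)) \<le> card {1..p + chromatic_number G}"
    by (intro card_mono) auto
  then show "chromatic_number (cone p G) \<le> p + chromatic_number G"
    using * card_verts_cone[OF fin] by (intro chromatic_number_le) (auto simp: proper_L_coloring_def)
  obtain f where f: "proper_m_coloring (cone p G) (chromatic_number (cone p G)) f"
    using optimal_coloring[OF simple_graph_cone[OF G]] .
  have f1: "proper_coloring (cone p G) f" "f ` verts (cone p G) \<subseteq> {1..chromatic_number (cone p G)}"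
    using f by (auto simp: proper_m_coloring_def)
  have "chromatic_number G \<le> card ((f \<circ> Inr) ` verts G)"
    using chromatic_number_le[OF fin proper_coloring_coneD(1)[OF fin f1(1)]] by blast
  moreover have "card (f ` verts (cone p G)) \<le> chromatic_number (cone p G)"
    using card_mono[OF _ f1(2)] by simp
  ultimately show "p + chromatic_number G \<le> chromatic_number (cone p G)"
    using proper_coloring_coneD(2)[OF fin f1(1)] by linarith
qed

lemma card_clique_cone_le:
  assumes G: "simple_graph G" and K: "clique (cone p G) K"
  shows "card K \<le> p + clique_number G"
proof -
  let ?B = "Inr -` K"
  have fin: "finite (verts G)" using G by (simp add: simple_graph_def)
  have KV: "K \<subseteq> Inl ` {..<p} \<union> Inr ` verts G" using K by (auto simp: clique_def verts_cone)
  have "clique G ?B"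
    unfolding clique_def
  proof (intro conjI ballI impI)
    show "?B \<subseteq> verts G" using KV by auto
    fix u v assume "u \<in> ?B" "v \<in> ?B" "u \<noteq> v"
    then have "{Inr u, Inr v} \<in> edges (cone p G)" using K by (auto simp: clique_def)
    then show "{u, v} \<in> edges G" by (simp add: edges_cone)
  qed
  then have "card ?B \<le> clique_number G" by (rule card_clique_le[OF G])
  moreover have "finite ?B" using KV fin by (intro finite_subset[OF _ fin]) auto
  moreover have "K \<subseteq> Inl ` {..<p} \<union> Inr ` ?B" using KV by auto
  ultimately have "card K \<le> card (Inl ` {..<p} \<union> Inr ` ?B :: (nat + 'a) set)"
    by (intro card_mono finite_UnI finite_imageI finite_lessThan)
  also have "\<dots> \<le> card (Inl ` {..<p} :: (nat + 'a) set) + card (Inr ` ?B :: (nat + 'a) set)" by (rule card_Un_le)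
  also have "\<dots> = p + card ?B" by (simp only: card_image inj_Inl inj_Inr card_lessThan)
  finally show ?thesis using \<open>card ?B \<le> clique_number G\<close> by simp
qed

text \<open>
  A maximum clique attains the bound. A subgraph that is too large to lie on a clique has independence
  number at least two, which halves its ratio, and \<open>p + card (verts G)\<close> is at most twice the bound.
\<close>

lemma hall_ratio_cone:
  assumes G: "simple_graph G" and p: "card (verts G) \<le> p"
  shows "hall_ratio (cone p G) = real (p + clique_number G)"
  unfolding hall_ratio_def
proof (rule Max_eqI)
  let ?k = "p + clique_number G"
  have fin: "finite (verts G)" using G by (simp add: simple_graph_def)
  have sM: "simple_graph (cone p G)" by (rule simple_graph_cone[OF G])
  show "finite {real (card (verts H)) / real (independence_number H) | H. subgraph H (cone p G)}"
    by (rule finite_hall_ratios[OF sM])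
  show "y \<le> real ?k"
    if "y \<in> {real (card (verts H)) / real (independence_number H) | H. subgraph H (cone p G)}" for y
  proof -
    obtain H where H: "subgraph H (cone p G)" "y = real (card (verts H)) / real (independence_number H)"
      using \<open>y \<in> _\<close> by blast
    have sH: "simple_graph H" and HM: "verts H \<subseteq> verts (cone p G)" "edges H \<subseteq> edges (cone p G)"
      using H by (auto simp: subgraph_def)
    have a1: "1 \<le> independence_number H" by (rule independence_number_pos[OF sH])
    have "card (verts H) \<le> independence_number H * ?k"
    proof (cases "card (verts H) \<le> ?k")
      case True
      have "?k \<le> independence_number H * ?k" using mult_le_mono1[OF a1, of ?k] by simp
      with True show ?thesis by (rule order_trans)
    next
      case False
      then have "\<not> clique (cone p G) (verts H)" using card_clique_cone_le[OF G] by blast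
      then obtain u v where uv: "u \<in> verts H" "v \<in> verts H" "u \<noteq> v" "{u, v} \<notin> edges (cone p G)"
        using HM(1) by (auto simp: clique_def)
      then have "independent_set H {u, v}"
        using HM(2) simple_graph_edgeD(1)[OF sH, of u u] simple_graph_edgeD(1)[OF sH, of v v]
        by (auto simp: independent_set_def insert_commute)
      then have "2 \<le> independence_number H" using card_independent_set_le[OF sH] uv(3) by fastforce
      then have 2: "2 * ?k \<le> independence_number H * ?k" by (rule mult_le_mono1)
      have "card (verts H) \<le> p + card (verts G)"
        using card_mono[OF card_verts_cone(1)[OF fin] HM(1)] card_verts_cone(2)[OF fin] by simp
      then have "card (verts H) \<le> 2 * ?k" using p by arith
      then show ?thesis using 2 by (rule order_trans)
    qed
    then have "real (card (verts H)) \<le> real (independence_number H) * real ?k"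
      by (metis of_nat_le_iff of_nat_mult)
    then show ?thesis using H(2) a1 by (simp add: divide_le_eq mult.commute)
  qed
  obtain K where K: "clique G K" "card K = clique_number G" using maximum_clique[OF G] .
  let ?W = "Inl ` {..<p} \<union> Inr ` K :: (nat + 'a) set"
  define H where "H = \<lparr>verts = ?W, edges = {{u, v} | u v. u \<in> ?W \<and> v \<in> ?W \<and> u \<noteq> v}\<rparr>"
  have KV: "K \<subseteq> verts G" using K by (simp add: clique_def)
  then have finK: "finite K" using fin finite_subset by blast
  have cW: "card ?W = ?k"
    using K(2) finK by (subst card_Un_disjoint) (auto simp: card_image)
  have "verts G \<noteq> {}" using G by (simp add: simple_graph_def)
  then have "0 < card (verts G)" using fin by (simp add: card_gt_0_iff)
  then have "0 < p" using p by linarith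
  then have sH: "simple_graph H"
    using finK by (auto simp: simple_graph_def H_def)
  have "{u, v} \<in> edges (cone p G)" if "u \<in> ?W" "v \<in> ?W" "u \<noteq> v" for u v
  proof -
    have "{x, y} \<in> edges G" if "x \<in> K" "y \<in> K" "x \<noteq> y" for x y
      using K(1) that by (simp add: clique_def)
    then show ?thesis
      using that KV by (cases u; cases v) (auto simp: edges_cone)
  qed
  then have sub: "subgraph H (cone p G)"
    using sH KV by (auto simp: subgraph_def H_def verts_cone)
  obtain I where I: "independent_set H I" "card I = independence_number H"
    using maximum_independent_set[OF sH] .
  have "card I \<le> 1"
  proof (rule card_le_Suc0_iff_eq[THEN iffD2, unfolded One_nat_def[symmetric]])
    have IW: "I \<subseteq> ?W" using I(1) by (auto simp: independent_set_def H_def)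
    then show "finite I" using finK finite_subset by blast
    have "{u, v} \<in> edges H" if "u \<in> I" "v \<in> I" "u \<noteq> v" for u v
    proof -
      have "u \<in> ?W" "v \<in> ?W" using that IW by blast+
      then show ?thesis unfolding H_def using that(3) by simp blast
    qed
    then show "\<forall>u\<in>I. \<forall>v\<in>I. u = v"
      using I(1) unfolding independent_set_def by blast
  qed
  then have "independence_number H = 1" using I(2) independence_number_pos[OF sH] by simp
  then have "real ?k = real (card (verts H)) / real (independence_number H)"
    using cW by (simp add: H_def)
  then show "real ?k \<in> {real (card (verts H)) / real (independence_number H) | H. subgraph H (cone p G)}"
    using sub by blast
qed

section \<open>Flexibility of the join\<close>

text \<open>
  Requesting one color on the clique and \<open>S\<close> together is just too much for a single satisfied vertex,
  and two vertices of the same color must both lie in \<open>S\<close>.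
\<close>

lemma coloring_repeating_on_subset:
  assumes G: "simple_graph G"
    and flex: "flexible (p + chromatic_number G) (1 / real (p + clique_number G)) (cone p G)"
    and S: "S \<subseteq> verts G" "card S = clique_number G + 1"
  shows "\<exists>f. proper_m_coloring G (chromatic_number G) f \<and> card (f ` S) \<le> clique_number G"
proof -
  let ?\<omega> = "clique_number G" and ?k = "p + chromatic_number G"
  have fin: "finite (verts G)" using G by (simp add: simple_graph_def)
  then have finS: "finite S" using S finite_subset by blast
  define D where "D = (Inl ` {..<p} \<union> Inr ` S :: (nat + 'a) set)"
  have DV: "D \<subseteq> verts (cone p G)" using S by (auto simp: D_def verts_cone)
  have finD: "finite D" using finS by (simp add: D_def)
  have cD: "card D = p + ?\<omega> + 1"
    unfolding D_def using S finS by (subst card_Un_disjoint) (auto simp: card_image)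
  define r where "r = (\<lambda>v. if v \<in> D then Some (1::nat) else None)"
  have domr: "dom r = D" by (auto simp: r_def split: if_splits)
  have "k_assignment (cone p G) ?k (\<lambda>_. {1..?k})" by (simp add: k_assignment_def)
  moreover have "request (cone p G) (\<lambda>_. {1..?k}) r"
    unfolding request_def domr using DV cD chromatic_number_pos[OF G] by (auto simp: r_def)
  ultimately have "satisfiable (1 / real (p + ?\<omega>)) (cone p G) (\<lambda>_. {1..?k}) r"
    using flex by (simp add: flexible_def pair_flexible_def)
  then obtain f where "proper_L_coloring (cone p G) (\<lambda>_. {1..?k}) f"
    and sat: "1 / real (p + ?\<omega>) * real (card D) \<le> real (card {v \<in> D. f v = the (r v)})"
    unfolding satisfiable_def domr by blast
  then have f: "proper_coloring (cone p G) f" "f ` verts (cone p G) \<subseteq> {1..?k}"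
    unfolding proper_L_coloring_def by blast+
  have c1: "{v \<in> D. f v = the (r v)} = {v \<in> D. f v = 1}" by (auto simp: r_def)
  obtain v where "v \<in> verts G" using G by (auto simp: simple_graph_def)
  then have "clique G {v}" by (simp add: clique_def)
  then have "1 \<le> ?\<omega>" using card_clique_le[OF G] by fastforce
  then have "1 < 1 / real (p + ?\<omega>) * real (card D)" unfolding cD by (simp add: field_simps)
  then have "1 < card {v \<in> D. f v = 1}" using sat unfolding c1 by simp
  then obtain x y where xy: "x \<in> D" "y \<in> D" "f x = 1" "f y = 1" "x \<noteq> y"
    using card_le_Suc0_iff_eq[of "{v \<in> D. f v = 1}"] finD by auto
  have nadj: "{x, y} \<notin> edges (cone p G)"
    using f(1) xy DV unfolding proper_coloring_def by (metis subsetD)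
  obtain u w where uw: "x = Inr u" "y = Inr w" "u \<in> S" "w \<in> S"
    using nadj xy S by (auto simp: D_def edges_cone)
  let ?h = "f \<circ> Inr"
  have "?h u = ?h w" "u \<noteq> w" using xy uw by auto
  then have "\<not> inj_on ?h S" using uw unfolding inj_on_def by blast
  then have hS: "card (?h ` S) \<le> ?\<omega>"
    using card_image_le[OF finS, of ?h] eq_card_imp_inj_on[OF finS, of ?h] S(2) by linarith
  have "card (f ` verts (cone p G)) \<le> ?k" using card_mono[OF _ f(2)] by simp
  then have "card (?h ` verts G) \<le> chromatic_number G"
    using proper_coloring_coneD(2)[OF fin f(1)] by linarith
  then obtain \<phi> where \<phi>: "inj_on \<phi> (?h ` verts G)" "proper_m_coloring G (chromatic_number G) (\<phi> \<circ> ?h)"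
    using proper_recoloring[OF fin proper_coloring_coneD(1)[OF fin f(1)]] by blast
  have "card ((\<phi> \<circ> ?h) ` S) = card (\<phi> ` ?h ` S)" by (simp add: image_comp)
  also have "\<dots> \<le> card (?h ` S)" using finS by (intro card_image_le) auto
  finally show ?thesis using \<phi>(2) hS by (meson le_trans)
qed

text \<open>
  One satisfied request is enough for domains of at most \<open>p + clique_number G\<close> vertices, and two for the
  others. Assumption \<open>rep\<close> enters only when a large domain requests a single color \<open>c\<close>: then both
  satisfied vertices have to share a color class of \<open>G\<close>.
\<close>

lemma flexible_cone:
  assumes G: "simple_graph G" and p: "card (verts G) * card (verts G) + 2 < p"
    and rep: "\<And>S. S \<subseteq> verts G \<Longrightarrow> card S = clique_number G + 1 \<Longrightarrow>
      \<exists>f. proper_m_coloring G (chromatic_number G) f \<and> card (f ` S) \<le> clique_number G"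
  shows "flexible (p + chromatic_number G) (1 / real (p + clique_number G)) (cone p G)"
  unfolding flexible_def pair_flexible_def
proof (intro allI impI)
  fix L :: "nat + 'a \<Rightarrow> nat set" and r
  assume L: "k_assignment (cone p G) (p + chromatic_number G) L" and r: "request (cone p G) L r"
  let ?n = "card (verts G)" and ?\<omega> = "clique_number G" and ?\<chi> = "chromatic_number G"
  define P V D where "P = (Inl ` {..<p} :: (nat + 'a) set)"
    and "V = (Inr ` verts G :: (nat + 'a) set)" and "D = dom r"
  have finG: "finite (verts G)" using G by (simp add: simple_graph_def)
  have fin: "finite P" "finite V" using finG by (auto simp: P_def V_def)
  have disj: "P \<inter> V = {}" by (auto simp: P_def V_def)
  have cards: "card P = p" "card V = ?n" by (simp_all add: P_def V_def card_image)
  have PV: "verts (cone p G) = P \<union> V" by (simp add: P_def V_def verts_cone)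
  have lists: "finite (L v) \<and> card P + ?\<chi> \<le> card (L v)" if "v \<in> P \<union> V" for v
    using L that by (simp add: k_assignment_def PV cards)
  have D: "D \<subseteq> P \<union> V" "D \<noteq> {}" and rL: "\<And>v. v \<in> D \<Longrightarrow> the (r v) \<in> L v"
    using r unfolding request_def PV D_def by auto
  have finD: "finite D" using D(1) fin finite_subset by blast
  have np: "?n \<le> p" using p le_square[of ?n] by linarith
  have chi: "1 \<le> ?\<chi>" by (rule chromatic_number_pos[OF G])
  obtain g where g: "proper_m_coloring G ?\<chi> g" using optimal_coloring[OF G] .
  have gV: "case_sum (\<lambda>_. 0) g ` V \<subseteq> {1..?\<chi>}" if "proper_m_coloring G ?\<chi> g" for g
    using that by (auto simp: V_def proper_m_coloring_def)
  have sat: "satisfiable (1 / real (p + ?\<omega>)) (cone p G) L r"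
    if "refining_coloring P V L (case_sum (\<lambda>_. 0) g) f" "proper_m_coloring G ?\<chi> g"
      "A \<subseteq> D" "\<And>v. v \<in> A \<Longrightarrow> f v = the (r v)" "card D \<le> card A * (p + ?\<omega>)" for f g A
    using that proper_L_coloring_coneI[of p G L g f] finD p
    by (intro satisfiableI[of _ L f r A]) (auto simp: P_def V_def D_def proper_m_coloring_def)
  show "satisfiable (1 / real (p + ?\<omega>)) (cone p G) L r"
  proof (cases "card D \<le> p + ?\<omega>")
    case True
    obtain d where d: "d \<in> D" using D(2) by blast
    have "\<exists>f. refining_coloring P V L (case_sum (\<lambda>_. 0) g) f \<and> f d = the (r d)"
    proof (rule refining_coloring_one_request[OF fin disj _ lists gV[OF g] chi])
      show "card V * card V + 1 < card P" using p cards by simp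
      show "d \<in> P \<union> V" using d D(1) by blast
      show "the (r d) \<in> L d" by (rule rL[OF d])
    qed
    then obtain f where "refining_coloring P V L (case_sum (\<lambda>_. 0) g) f" "f d = the (r d)" by blast
    then show ?thesis using True d g by (intro sat[of g f "{d}"]) auto
  next
    case False
    have "card D \<le> card (P \<union> V)" using D(1) fin by (intro card_mono) auto
    also have "\<dots> \<le> card P + card V" by (rule card_Un_le)
    finally have two: "card D \<le> 2 * (p + ?\<omega>)" using cards np by arith
    have "\<not> D \<subseteq> V" using card_mono[OF fin(2), of D] cards np False by auto
    then obtain d where d: "d \<in> D" "d \<in> P" using D(1) by blast
    show ?thesis
    proof (cases "\<exists>e\<in>D. the (r e) \<noteq> the (r d)")
      case True
      then obtain e where e: "e \<in> D" "the (r e) \<noteq> the (r d)" by blast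
      then have "e \<noteq> d" by blast
      have "\<exists>f. refining_coloring P V L (case_sum (\<lambda>_. 0) g) f \<and> f d = the (r d) \<and> f e = the (r e)"
      proof (rule refining_coloring_two_requests[OF fin disj _ lists gV[OF g] chi])
        show "card V * card V + 2 < card P" using p cards by simp
        show "e \<in> P \<union> V" using e(1) D(1) by blast
      qed (use d e \<open>e \<noteq> d\<close> rL in auto)
      then obtain f where f: "refining_coloring P V L (case_sum (\<lambda>_. 0) g) f"
        "f d = the (r d)" "f e = the (r e)" by blast
      have "card {d, e} = 2" using \<open>e \<noteq> d\<close> by simp
      then show ?thesis using two d e f g by (intro sat[of g f "{d, e}"]) auto
    next
      case False
      let ?c = "the (r d)"
      have const: "the (r v) = ?c" if "v \<in> D" for v using False that by blast
      have "D \<subseteq> P \<union> Inr ` (Inr -` D)" using D(1) by (auto simp: V_def)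
      moreover have finB: "finite (Inr -` D)" using finD by (intro finite_vimageI) auto
      ultimately have "card D \<le> card (P \<union> Inr ` (Inr -` D))"
        using fin by (intro card_mono finite_UnI finite_imageI)
      also have "\<dots> \<le> card P + card (Inr ` (Inr -` D) :: (nat + 'a) set)" by (rule card_Un_le)
      also have "\<dots> = p + card (Inr -` D)" by (simp only: cards card_image inj_Inr)
      finally have "?\<omega> + 1 \<le> card (Inr -` D)" using \<open>\<not> card D \<le> p + ?\<omega>\<close> by linarith
      then obtain S where S: "S \<subseteq> Inr -` D" "card S = ?\<omega> + 1" "finite S"
        using obtain_subset_with_card_n by metis
      have "S \<subseteq> verts G" using S(1) D(1) by (auto simp: P_def V_def)
      from rep[OF this S(2)]
      obtain g' where g': "proper_m_coloring G ?\<chi> g'" "card (g' ` S) \<le> ?\<omega>" by blast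
      have "\<not> inj_on g' S" using g'(2) S(2) card_image[of g' S] by auto
      then obtain u v where uv: "u \<in> S" "v \<in> S" "u \<noteq> v" "g' u = g' v" unfolding inj_on_def by blast
      then have uD: "Inr u \<in> D" "Inr v \<in> D" using S by auto
      then have uV: "Inr u \<in> V" "Inr v \<in> V" using D(1) by (auto simp: P_def V_def)
      have "g' u \<in> {1..?\<chi>}" using gV[OF g'(1)] uV(1) by auto
      moreover have "card V * card V < card P" using p cards by simp
      ultimately have "\<exists>f. refining_coloring P V L (case_sum (\<lambda>_. 0) g') f
          \<and> (\<forall>w\<in>V. case_sum (\<lambda>_. 0) g' w = g' u \<and> ?c \<in> L w \<longrightarrow> f w = ?c)"
        by (intro refining_coloring_class[OF fin disj _ lists gV[OF g'(1)]])
      then obtain f where f: "refining_coloring P V L (case_sum (\<lambda>_. 0) g') f"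
        "\<forall>w\<in>V. case_sum (\<lambda>_. 0) g' w = g' u \<and> ?c \<in> L w \<longrightarrow> f w = ?c" by blast
      have "f (Inr u) = ?c" "f (Inr v) = ?c"
        using f(2) uV rL[OF uD(1)] rL[OF uD(2)] const uD uv(4) by auto
      moreover have "card {Inr u, Inr v :: nat + 'a} = 2" using uv(3) by simp
      ultimately show ?thesis
        using two uD f(1) g'(1) const by (intro sat[of g' f "{Inr u, Inr v}"]) auto
    qed
  qed
qed

theorem theorem8:
  fixes G :: "'a sgraph"
  assumes "simple_graph G"
  shows "(\<exists>N::nat. 1 \<le> N \<and>
            (\<forall>p\<ge>N. list_flexibility_number (join (complete_graph p) G)
                     = chromatic_number (join (complete_graph p) G)))
     \<longleftrightarrow>
         (\<forall>S. S \<subseteq> verts G \<and> card S = clique_number G + 1 \<longrightarrow>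
            (\<exists>f. proper_m_coloring G (chromatic_number G) f \<and>
                 card (f ` S) \<le> clique_number G))"
proof -
  let ?n = "card (verts G)"
  have flex_iff: "list_flexibility_number (cone p G) = chromatic_number (cone p G)
      \<longleftrightarrow> flexible (p + chromatic_number G) (1 / real (p + clique_number G)) (cone p G)"
    if "?n \<le> p" for p
    using list_flexibility_number_eq_chromatic_number_iff[OF simple_graph_cone[OF assms]]
      chromatic_number_cone[OF assms] hall_ratio_cone[OF assms that] by simp
  \<comment> \<open>For the forward direction, \<open>max N ?n\<close> makes the formula for the Hall ratio applicable.\<close>
  show ?thesis
  proof (intro iffI allI impI)
    fix S assume "\<exists>N::nat. 1 \<le> N \<and>
            (\<forall>p\<ge>N. list_flexibility_number (cone p G) = chromatic_number (cone p G))"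
      and S: "S \<subseteq> verts G \<and> card S = clique_number G + 1"
    then obtain N where "\<forall>p\<ge>N. list_flexibility_number (cone p G) = chromatic_number (cone p G)"
      by blast
    then have "list_flexibility_number (cone (max N ?n) G) = chromatic_number (cone (max N ?n) G)"
      by simp
    then have "flexible (max N ?n + chromatic_number G)
        (1 / real (max N ?n + clique_number G)) (cone (max N ?n) G)"
      using flex_iff[of "max N ?n"] by simp
    then show "\<exists>f. proper_m_coloring G (chromatic_number G) f \<and> card (f ` S) \<le> clique_number G"
      using coloring_repeating_on_subset[OF assms] S by blast
  next
    assume rep: "\<forall>S. S \<subseteq> verts G \<and> card S = clique_number G + 1 \<longrightarrow>
            (\<exists>f. proper_m_coloring G (chromatic_number G) f \<and> card (f ` S) \<le> clique_number G)"
    have "list_flexibility_number (cone p G) = chromatic_number (cone p G)" if "?n * ?n + 3 \<le> p" for p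
    proof -
      have "?n \<le> p" using that le_square[of ?n] by linarith
      moreover have "?n * ?n + 2 < p" using that by linarith
      ultimately show ?thesis using flex_iff flexible_cone[OF assms] rep by blast
    qed
    then show "\<exists>N::nat. 1 \<le> N \<and>
            (\<forall>p\<ge>N. list_flexibility_number (cone p G) = chromatic_number (cone p G))"
      by (intro exI[of _ "?n * ?n + 3"]) auto
  qed
qed

end
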